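(* In the setting of the context, let $H_\rho(x,y)=g(x,y)-g_\rho(x,y)$. Then NNAMCQ (equivalently, MFCQ) fails at every feasible point of the exact Moreau-gap formulation $H_\rho\le0$ over $C$; that is, for every $w\in C$ with $H_\rho(w)\le0$, one has $H_\rho(w)=0$ and $0\in\nabla H_\rho(w)+N_C(w)$. On the other hand, for every $\delta>0$, the relaxed constraint $H_\rho\le\delta$ admits a strictly feasible point, i.e. there exists $w\in C$ with $H_\rho(w)<\delta$.
   Context: $X\subset\mathbb R^n$ and $Y\subset\mathbb R^m$ are nonempty, compact, convex; $C=X\times Y$; $g$ is real-valued and continuously differentiable on a neighborhood of $C$ with $\nabla g$ Lipschitz on $C$. $\sigma\ge0$ is such that $g(x,\cdot)+\frac\sigma2\|\cdot\|^2$ is convex on $Y$ for every $x\in X$; $\rho>0$ with $\rho\sigma<1$. $g_\rho(x,y)=\min_{z\in Y}\{g(x,z)+\frac1{2\rho}\|z-y\|^2\}$, with unique minimizer $z_\rho(x,y)$; $H_\rho$ is continuously differentiable on $C$ with $\nabla H_\rho(x,y)=\bigl(\nabla_xg(x,y)-\nabla_xg(x,z_\rho(x,y)),\ \nabla_yg(x,y)-\rho^{-1}(y-z_\rho(x,y))\bigr)$. $N_C$ is the normal cone. For a smooth inequality $R(w)\le0$ over the closed convex set $C$, NNAMCQ holds at a feasible point $w$ if $0\notin\nabla R(w)+N_C(w)$ whenever $R(w)=0$; for a single smooth inequality this is known to be equivalent to the Mangasarian--Fromovitz constraint qualification (MFCQ) relative to $C$. *)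

theory Defs
  imports "HOL-Analysis.Analysis"
begin

text \<open>The gradient is meaningful only at points where a full Frechet derivative exists; the
  Euclidean structure on a product type makes \<open>fst\<close> and \<open>snd\<close> of a gradient its partial gradients.\<close>

definition gradient :: "('a::real_inner \<Rightarrow> real) \<Rightarrow> 'a \<Rightarrow> 'a" where
  "gradient f x = (THE D. GDERIV f x :> D)"

text \<open>Normal cone of convex analysis, empty outside the set.\<close>

definition normal_cone :: "'a::real_inner set \<Rightarrow> 'a \<Rightarrow> 'a set" where
  "normal_cone C w = {v. w \<in> C \<and> (\<forall>c\<in>C. v \<bullet> (c - w) \<le> 0)}"

text \<open>Bouligand tangent cone.\<close>

definition tangent_cone :: "'a::real_normed_vector set \<Rightarrow> 'a \<Rightarrow> 'a set" where
  "tangent_cone C w = {d. \<exists>(c :: nat \<Rightarrow> 'a) (t :: nat \<Rightarrow> real).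
      (\<forall>k. c k \<in> C \<and> t k > 0) \<and> t \<longlonglongrightarrow> 0 \<and> (\<lambda>k. (c k - w) /\<^sub>R t k) \<longlonglongrightarrow> d}"

text \<open>Constraint qualifications for the single smooth inequality \<open>R w \<le> 0\<close> over \<open>C\<close>, to be used
  at feasible points \<open>w\<close>. Both hold vacuously where the inequality is inactive.\<close>

definition nnamcq :: "'a::real_inner set \<Rightarrow> ('a \<Rightarrow> real) \<Rightarrow> 'a \<Rightarrow> bool" where
  "nnamcq C R w \<longleftrightarrow> (R w = 0 \<longrightarrow> 0 \<notin> (\<lambda>v. gradient R w + v) ` normal_cone C w)"

definition mfcq :: "'a::real_inner set \<Rightarrow> ('a \<Rightarrow> real) \<Rightarrow> 'a \<Rightarrow> bool" where
  "mfcq C R w \<longleftrightarrow> (R w = 0 \<longrightarrow> (\<exists>d\<in>tangent_cone C w. gradient R w \<bullet> d < 0))"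

definition moreau_objective ::
    "('a \<times> 'b::real_normed_vector \<Rightarrow> real) \<Rightarrow> real \<Rightarrow> 'a \<times> 'b \<Rightarrow> 'b \<Rightarrow> real" where
  "moreau_objective g \<rho> w z = g (fst w, z) + 1 / (2 * \<rho>) * (norm (z - snd w))\<^sup>2"

text \<open>The infimum is a minimum when \<open>Y\<close> is nonempty and compact and \<open>g (fst w, _)\<close> is continuous
  on \<open>Y\<close>.\<close>

definition moreau_env ::
    "('a \<times> 'b::real_normed_vector \<Rightarrow> real) \<Rightarrow> 'b set \<Rightarrow> real \<Rightarrow> 'a \<times> 'b \<Rightarrow> real" where
  "moreau_env g Y \<rho> w = (INF z\<in>Y. moreau_objective g \<rho> w z)"

definition moreau_argmin ::
    "('a \<times> 'b::real_normed_vector \<Rightarrow> real) \<Rightarrow> 'b set \<Rightarrow> real \<Rightarrow> 'a \<times> 'b \<Rightarrow> 'b" where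
  "moreau_argmin g Y \<rho> w = (THE z. is_arg_min (moreau_objective g \<rho> w) (\<lambda>z. z \<in> Y) z)"

definition moreau_gap ::
    "('a \<times> 'b::real_normed_vector \<Rightarrow> real) \<Rightarrow> 'b set \<Rightarrow> real \<Rightarrow> 'a \<times> 'b \<Rightarrow> real" where
  "moreau_gap g Y \<rho> w = g w - moreau_env g Y \<rho> w"

definition moreau_gap_gradient ::
    "('a::real_inner \<times> 'b::real_inner \<Rightarrow> real) \<Rightarrow> 'b set \<Rightarrow> real \<Rightarrow> 'a \<times> 'b \<Rightarrow> 'a \<times> 'b" where
  "moreau_gap_gradient g Y \<rho> w =
     (let z = moreau_argmin g Y \<rho> w in
       (fst (gradient g w) - fst (gradient g (fst w, z)),
        snd (gradient g w) - (1 / \<rho>) *\<^sub>R (snd w - z)))"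

end

theory Submission
  imports Defs
begin

text \<open>Weak convexity and \<open>\<rho>\<sigma> < 1\<close> make the Moreau objective strongly convex in \<open>z\<close>, so its
  minimizer over \<open>Y\<close> is unique, and Danskin's theorem (uniqueness is needed only at the base point)
  gives the differentiability of the gap, even at boundary points of \<open>X \<times> Y\<close>. Since \<open>z = y\<close> is
  admissible, the gap is nonnegative on \<open>X \<times> Y\<close>; a feasible point is therefore a minimizer of
  the gap over a convex set, and the first-order optimality condition contradicts both constraint
  qualifications. The gap vanishes at \<open>(x, y)\<close> whenever \<open>y\<close> minimizes \<open>g (x, _)\<close> over \<open>Y\<close>.\<close>

section \<open>Uniqueness and existence of gradients\<close>

lemma GDERIV_unique:
  assumes "GDERIV f x :> D" "GDERIV f x :> E"
  shows "D = E"
proof -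
  have "(\<lambda>h. h \<bullet> D) = (\<lambda>h. h \<bullet> E)"
    using assms unfolding gderiv_def by (rule has_derivative_unique)
  then have "(D - E) \<bullet> D = (D - E) \<bullet> E"
    by metis
  then show ?thesis
    by (metis inner_diff_right inner_eq_zero_iff right_minus_eq)
qed

lemma gradient_eq: "GDERIV f x :> D \<Longrightarrow> gradient f x = D"
  unfolding gradient_def by (blast intro: GDERIV_unique)

text \<open>Riesz representation in finite dimension: the derivative is a linear functional, and its
  adjoint applied to 1 is the representing vector.\<close>

lemma GDERIV_gradient:
  fixes f :: "'a::euclidean_space \<Rightarrow> real"
  assumes "f differentiable (at x)"
  shows "GDERIV f x :> gradient f x"
proof -
  from assms obtain f' where f': "(f has_derivative f') (at x)"
    unfolding differentiable_def by blast
  have "f' = (\<lambda>h. h \<bullet> adjoint f' 1)"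
    using adjoint_works[OF has_derivative_linear[OF f'], of _ 1] by auto
  with f' have "GDERIV f x :> adjoint f' 1"
    unfolding gderiv_def by simp
  then show ?thesis
    using gradient_eq by metis
qed

subsection \<open>Danskin's theorem\<close>

text \<open>The tube lemma in filter form: the interior of \<open>{p. P p}\<close> is an open set
  around the slice \<open>{w} \<times> K\<close>, so by compactness it contains a whole tube
  \<open>V \<times> K\<close>.\<close>

lemma eventually_nhds_compact:
  assumes "compact K" and ev: "\<And>z. z \<in> K \<Longrightarrow> eventually P (nhds (w, z))"
  shows "\<forall>\<^sub>F v in nhds w. \<forall>z\<in>K. P (v, z)"
proof -
  define W where "W = interior {p. P p}"
  have "{w} \<times> K \<subseteq> W"
  proof clarify
    fix z assume "z \<in> K"
    from ev[OF this] obtain S where "open S" "(w, z) \<in> S" "S \<subseteq> {p. P p}"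
      unfolding eventually_nhds by blast
    then show "(w, z) \<in> W"
      unfolding W_def by (rule interiorI)
  qed
  then have "\<exists>V. w \<in> V \<and> open V \<and> V \<times> K \<subseteq> W"
    by (intro Elementary_Topology.tube_lemma assms(1)) (auto simp: W_def)
  then obtain V where V: "w \<in> V" "open V" "V \<times> K \<subseteq> W"
    by blast
  have "\<forall>z\<in>K. P (v, z)" if "v \<in> V" for v
  proof
    fix z assume "z \<in> K"
    with V(3) that have "(v, z) \<in> W"
      by auto
    then show "P (v, z)"
      using interior_subset unfolding W_def by fastforce
  qed
  with V show ?thesis
    unfolding eventually_nhds by blast
qed

text \<open>Near \<open>(w, z\<^sub>0)\<close> the function
  \<open>f (u, z) - u \<bullet> G (w, z\<^sub>0)\<close> of \<open>u\<close> has a derivative of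
  norm below \<open>e\<close>, because \<open>G\<close> is continuous there in both variables
  jointly. The mean value inequality then bounds the error with one vector for all nearby
  \<open>z\<close>.\<close>

lemma GDERIV_uniform_linearization:
  fixes f :: "'a::real_inner \<times> 'b::metric_space \<Rightarrow> real"
  assumes der: "\<forall>\<^sub>F p in nhds (w, z\<^sub>0). GDERIV (\<lambda>v. f (v, snd p)) (fst p) :> G p"
    and cont: "isCont G (w, z\<^sub>0)" and "e > 0"
  shows "\<forall>\<^sub>F p in nhds (w, z\<^sub>0).
    \<bar>f p - f (w, snd p) - (fst p - w) \<bullet> G (w, z\<^sub>0)\<bar> \<le> e * norm (fst p - w)"
proof -
  let ?D = "G (w, z\<^sub>0)"
  have "\<forall>\<^sub>F p in nhds (w, z\<^sub>0). dist (G p) ?D < e"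
    using cont \<open>e > 0\<close> unfolding isCont_def tendsto_at_iff_tendsto_nhds by (rule tendstoD)
  with der have "\<forall>\<^sub>F p in nhds (w, z\<^sub>0).
      GDERIV (\<lambda>v. f (v, snd p)) (fst p) :> G p \<and> dist (G p) ?D < e"
    by eventually_elim simp
  then obtain W where W: "open W" "(w, z\<^sub>0) \<in> W"
    "\<And>p. p \<in> W \<Longrightarrow> GDERIV (\<lambda>v. f (v, snd p)) (fst p) :> G p \<and> dist (G p) ?D < e"
    unfolding eventually_nhds by blast
  from W(1,2) obtain S T where S: "open S" "w \<in> S" and T: "open T" "z\<^sub>0 \<in> T"
    and "S \<times> T \<subseteq> W"
    by (elim open_prod_elim) auto
  then have ST: "GDERIV (\<lambda>v. f (v, z)) v :> G (v, z) \<and> dist (G (v, z)) ?D < e"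
    if "v \<in> S" "z \<in> T" for v z
    using W(3)[of "(v, z)"] that by auto
  \<comment> \<open>The mean value inequality needs a convex domain, hence a ball in the first
    factor.\<close>
  from S obtain r where r: "r > 0" "ball w r \<subseteq> S"
    using open_contains_ball by blast
  have lin: "\<bar>f (v, z) - f (w, z) - (v - w) \<bullet> ?D\<bar> \<le> e * norm (v - w)"
    if "v \<in> ball w r" "z \<in> T" for v z
  proof -
    have "norm ((f (v, z) - v \<bullet> ?D) - (f (w, z) - w \<bullet> ?D)) \<le> e * norm (v - w)"
    proof (rule differentiable_bound[of "ball w r" "\<lambda>u. f (u, z) - u \<bullet> ?D"
          "\<lambda>u h. h \<bullet> G (u, z) - h \<bullet> ?D"])
      fix u assume "u \<in> ball w r"
      with ST[of u z] that r have u: "GDERIV (\<lambda>v. f (v, z)) u :> G (u, z)" "dist (G (u, z)) ?D < e"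
        by auto
      show "((\<lambda>u. f (u, z) - u \<bullet> ?D) has_derivative (\<lambda>h. h \<bullet> G (u, z) - h \<bullet> ?D))
          (at u within ball w r)"
        using u(1) unfolding gderiv_def
        by (rule has_derivative_diff[OF has_derivative_at_withinI
              bounded_linear_imp_has_derivative[OF bounded_linear_inner_left]])
      show "onorm (\<lambda>h. h \<bullet> G (u, z) - h \<bullet> ?D) \<le> e"
      proof (rule onorm_bound)
        fix h
        have "norm (h \<bullet> G (u, z) - h \<bullet> ?D) \<le> norm h * norm (G (u, z) - ?D)"
          unfolding inner_diff_right[symmetric] real_norm_def by (rule Cauchy_Schwarz_ineq2)
        also have "\<dots> \<le> norm h * e"
          using u(2) by (intro mult_left_mono) (auto simp: dist_norm)
        finally show "norm (h \<bullet> G (u, z) - h \<bullet> ?D) \<le> e * norm h"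
          by (simp add: mult.commute)
      qed (use \<open>e > 0\<close> in simp)
    qed (use that r in auto)
    then show ?thesis
      by (simp add: inner_diff_left algebra_simps)
  qed
  have "\<forall>\<^sub>F p in nhds (w, z\<^sub>0). p \<in> ball w r \<times> T"
    using T r by (intro eventually_nhds_in_open open_Times) auto
  then show ?thesis
    by eventually_elim (auto intro!: lin)
qed

text \<open>Danskin's theorem by a squeeze. Testing the infimum with the fixed point
  \<open>z\<^sub>0\<close> bounds it above by the linearization plus an error. The matching lower
  bound holds locally around each \<open>z\<close> in \<open>K\<close>, and compactness makes it
  uniform.\<close>

theorem GDERIV_INF_unique_minimizer:
  fixes f :: "'a::real_inner \<times> 'b::metric_space \<Rightarrow> real"
  assumes K: "compact K" "z\<^sub>0 \<in> K"
    and min: "\<And>z. z \<in> K \<Longrightarrow> z \<noteq> z\<^sub>0 \<Longrightarrow> f (w, z\<^sub>0) < f (w, z)"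
    and cont: "\<And>z. z \<in> K \<Longrightarrow> isCont f (w, z)"
    and der: "\<forall>\<^sub>F p in nhds (w, z\<^sub>0). GDERIV (\<lambda>v. f (v, snd p)) (fst p) :> G p"
    and contG: "isCont G (w, z\<^sub>0)"
  shows "GDERIV (\<lambda>v. INF z\<in>K. f (v, z)) w :> G (w, z\<^sub>0)"
proof -
  let ?D = "G (w, z\<^sub>0)" and ?M = "\<lambda>v. INF z\<in>K. f (v, z)"
  have M: "?M w = f (w, z\<^sub>0)"
    using K(2) min by (intro cInf_eq_minimum) (auto, metis less_eq_real_def)
  have "\<forall>\<^sub>F v in nhds w. norm (?M v - ?M w - (v - w) \<bullet> ?D) \<le> e * norm (v - w)"
    if "e > 0" for e
  proof -
    have lin: "\<forall>\<^sub>F p in nhds (w, z\<^sub>0).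
        \<bar>f p - f (w, snd p) - (fst p - w) \<bullet> ?D\<bar> \<le> e * norm (fst p - w)"
      by (rule GDERIV_uniform_linearization[OF der contG that])
    \<comment> \<open>Neighbourhoods may leave \<open>K\<close>, where
      \<open>f (w, z\<^sub>0)\<close> need not be minimal; hence the restriction to
      \<open>snd p \<in> K\<close>.\<close>
    have lower: "\<forall>\<^sub>F p in nhds (w, z). snd p \<in> K \<longrightarrow>
        f (w, z\<^sub>0) + (fst p - w) \<bullet> ?D - e * norm (fst p - w) \<le> f p" if "z \<in> K" for z
    proof (cases "z = z\<^sub>0")
      case True
      have "f (w, z\<^sub>0) \<le> f (w, z')" if "z' \<in> K" for z'
        using min that by force
      then show ?thesis
        unfolding True using lin by (auto elim!: eventually_mono simp: abs_le_iff) (smt (verit))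
    next
      case False
      \<comment> \<open>Away from the minimizer continuity suffices: at \<open>(w, z)\<close> the
        margin \<open>h\<close> is the strict gap \<open>f (w, z) - f (w, z\<^sub>0)\<close>, so it
        stays positive nearby.\<close>
      define h where "h p = f p - (f (w, z\<^sub>0) + (fst p - w) \<bullet> ?D - e * norm (fst p - w))" for p
      have "isCont h (w, z)"
        unfolding h_def using cont[OF \<open>z \<in> K\<close>] by (intro continuous_intros)
      then have "(h \<longlongrightarrow> h (w, z)) (nhds (w, z))"
        unfolding isCont_def tendsto_at_iff_tendsto_nhds .
      moreover have "0 < h (w, z)"
        using min[OF \<open>z \<in> K\<close> False] by (simp add: h_def)
      ultimately have "\<forall>\<^sub>F p in nhds (w, z). 0 < h p"
        by (rule order_tendstoD(1))
      then show ?thesis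
        by eventually_elim (simp add: h_def)
    qed
    have "\<forall>\<^sub>F v in nhds w. \<forall>z\<in>K.
        f (w, z\<^sub>0) + (v - w) \<bullet> ?D - e * norm (v - w) \<le> f (v, z)"
      using eventually_nhds_compact[OF K(1), of _ w, OF lower] by (auto elim!: eventually_mono)
    moreover have "\<forall>\<^sub>F v in nhds w. \<bar>f (v, z\<^sub>0) - f (w, z\<^sub>0) - (v - w) \<bullet> ?D\<bar> \<le> e * norm (v - w)"
    proof -
      have "((\<lambda>v. (v, z\<^sub>0)) \<longlongrightarrow> (w, z\<^sub>0)) (nhds w)"
        by (intro tendsto_intros filterlim_ident)
      from eventually_compose_filterlim[OF lin this] show ?thesis
        by simp
    qed
    ultimately show ?thesis
    proof eventually_elim
      case (elim v)
      \<comment> \<open>The uniform lower bound does double duty: it also shows that the family at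
        \<open>v\<close> is bounded below, which the infimum of reals requires.\<close>
      have "?M v \<le> f (v, z\<^sub>0)"
        using elim(1) K(2) by (intro cINF_lower bdd_belowI2) auto
      moreover have "f (w, z\<^sub>0) + (v - w) \<bullet> ?D - e * norm (v - w) \<le> ?M v"
        using elim(1) K(2) by (intro cINF_greatest) auto
      ultimately show ?case
        using elim(2) unfolding M by (simp add: abs_le_iff)
    qed
  qed
  then show ?thesis
    unfolding gderiv_def has_derivative_within_alt2
    by (auto intro: bounded_linear_inner_left simp: eventually_nhds_conv_at)
qed

subsection \<open>First-order optimality and constraint qualifications\<close>

text \<open>Restrict \<open>f\<close> to the segment from \<open>w\<close> to \<open>c\<close>,
  which convexity keeps in \<open>C\<close>: a negative slope at 0 would push \<open>f\<close> below
  its minimum. As the derivative is a full one, \<open>w\<close> may lie on the boundary.\<close>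

lemma neg_GDERIV_in_normal_cone:
  assumes D: "GDERIV f w :> D" and C: "convex C" "w \<in> C"
    and min: "\<And>c. c \<in> C \<Longrightarrow> f w \<le> f c"
  shows "- D \<in> normal_cone C w"
proof -
  have "0 \<le> D \<bullet> (c - w)" if "c \<in> C" for c
  proof -
    let ?\<gamma> = "\<lambda>t::real. w + t *\<^sub>R (c - w)"
    have "(f has_derivative (\<lambda>h. h \<bullet> D)) (at (?\<gamma> 0))"
      using D by (simp add: gderiv_def)
    then have "((\<lambda>t. f (?\<gamma> t)) has_derivative (\<lambda>s. (s *\<^sub>R (c - w)) \<bullet> D)) (at 0)"
      by (rule has_derivative_compose[rotated]) (auto intro!: derivative_eq_intros)
    then have der: "DERIV (\<lambda>t. f (?\<gamma> t)) 0 :> D \<bullet> (c - w)"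
      unfolding has_field_derivative_def by (simp add: inner_commute mult_commute_abs)
    show ?thesis
    proof (rule ccontr)
      assume "\<not> ?thesis"
      then obtain d where d: "d > 0" "\<And>t. 0 < t \<Longrightarrow> t < d \<Longrightarrow> f (?\<gamma> t) < f (?\<gamma> 0)"
        using DERIV_neg_dec_right[OF der] by auto
      \<comment> \<open>Halving \<open>d\<close> keeps \<open>t\<close> strictly inside the interval
        of decrease; the cap 1 keeps the point on the segment.\<close>
      define t where "t = min (d / 2) 1"
      have t: "0 < t" "t < d" "t \<le> 1"
        using d(1) by (auto simp: t_def)
      have "?\<gamma> t = (1 - t) *\<^sub>R w + t *\<^sub>R c"
        by (simp add: algebra_simps)
      also have "\<dots> \<in> C"
        using C that t by (intro convexD_alt) auto
      finally show False
        using min d(2)[OF t(1,2)] by fastforce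
    qed
  qed
  with C show ?thesis
    by (simp add: normal_cone_def)
qed

lemma neg_normal_cone_imp_not_nnamcq:
  assumes "R w = 0" "- gradient R w \<in> normal_cone C w"
  shows "0 \<in> (\<lambda>v. gradient R w + v) ` normal_cone C w" "\<not> nnamcq C R w"
proof -
  show *: "0 \<in> (\<lambda>v. gradient R w + v) ` normal_cone C w"
    using assms(2) by (force intro: rev_image_eqI)
  then show "\<not> nnamcq C R w"
    using assms(1) by (simp add: nnamcq_def)
qed

text \<open>Polarity of the two cones: the inequality holds for every quotient
  \<open>(c k - w) /\<^sub>R t k\<close> and passes to the limit.\<close>

lemma normal_cone_tangent_cone_nonpos:
  assumes "v \<in> normal_cone C w" "d \<in> tangent_cone C w"
  shows "v \<bullet> d \<le> 0"
proof -
  from assms(2) obtain c :: "nat \<Rightarrow> 'a" and t :: "nat \<Rightarrow> real"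
    where c: "\<And>k. c k \<in> C" "\<And>k. t k > 0" and lim: "(\<lambda>k. (c k - w) /\<^sub>R t k) \<longlonglongrightarrow> d"
    unfolding tangent_cone_def by blast
  have "(\<lambda>k. v \<bullet> ((c k - w) /\<^sub>R t k)) \<longlonglongrightarrow> v \<bullet> d"
    using lim by (intro tendsto_intros)
  moreover have "v \<bullet> ((c k - w) /\<^sub>R t k) \<le> 0" for k
    using assms(1) c[of k] by (simp add: normal_cone_def mult_nonneg_nonpos)
  ultimately show ?thesis
    by (intro LIMSEQ_le_const2) auto
qed

text \<open>By polarity no tangent direction is a descent direction. This treats MFCQ directly,
  without its equivalence with NNAMCQ.\<close>

lemma neg_normal_cone_imp_not_mfcq:
  assumes "R w = 0" "- gradient R w \<in> normal_cone C w"
  shows "\<not> mfcq C R w"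
  using assms normal_cone_tangent_cone_nonpos[OF assms(2)] by (force simp: mfcq_def)

subsection \<open>The Moreau envelope\<close>

text \<open>If \<open>v\<close> were a second minimizer, the parallelogram identity would place the
  value at the midpoint of \<open>u\<close> and \<open>v\<close> below the minimum by at least
  \<open>\<mu> * (norm (u - v))\<^sup>2 / 4\<close>.\<close>

lemma strongly_convex_minimizer_unique:
  fixes Y :: "'b::real_inner set"
  assumes Y: "convex Y" and conv: "convex_on Y (\<lambda>z. h z - \<mu> * (norm z)\<^sup>2)" and "\<mu> > 0"
    and u: "u \<in> Y" "\<And>z. z \<in> Y \<Longrightarrow> h u \<le> h z"
    and v: "v \<in> Y" "v \<noteq> u"
  shows "h u < h v"
proof (rule ccontr)
  assume "\<not> h u < h v"
  then have eq: "h v = h u"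
    using u(2)[OF v(1)] by simp
  define m where "m = (1 / 2) *\<^sub>R u + (1 / 2) *\<^sub>R v"
  have "m \<in> Y"
    unfolding m_def using Y u(1) v(1) by (intro convexD) auto
  have "h m - \<mu> * (norm m)\<^sup>2 \<le> (1 / 2) * (h u - \<mu> * (norm u)\<^sup>2) + (1 / 2) * (h v - \<mu> * (norm v)\<^sup>2)"
    using convex_onD[OF conv, of "1 / 2" u v] u(1) v(1) by (simp add: m_def)
  then have "h m \<le> h u - \<mu> * ((1 / 2) * (norm u)\<^sup>2 + (1 / 2) * (norm v)\<^sup>2 - (norm m)\<^sup>2)"
    unfolding eq by (simp add: algebra_simps)
  also have "(1 / 2) * (norm u)\<^sup>2 + (1 / 2) * (norm v)\<^sup>2 - (norm m)\<^sup>2 = (norm (u - v))\<^sup>2 / 4"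
    unfolding m_def power2_norm_eq_inner
    by (simp add: inner_add_left inner_add_right inner_diff_left inner_diff_right inner_commute
        field_simps)
  also have "h u - \<mu> * ((norm (u - v))\<^sup>2 / 4) < h u"
    using \<open>\<mu> > 0\<close> v(2) by simp
  finally show False
    using u(2)[OF \<open>m \<in> Y\<close>] by simp
qed

text \<open>Expanding the square, the penalty minus the subtracted quadratic is
  \<open>\<sigma> / 2 * (norm z)\<^sup>2\<close> plus a function affine in \<open>z\<close>; the
  former is the term that convexifies \<open>g\<close>.\<close>

lemma moreau_objective_minus_quadratic_convex:
  fixes g :: "'a \<times> 'b::real_inner \<Rightarrow> real"
  assumes "convex_on Y (\<lambda>z. g (fst w, z) + \<sigma> / 2 * (norm z)\<^sup>2)"
  shows "convex_on Y (\<lambda>z. moreau_objective g \<rho> w z - (1 / \<rho> - \<sigma>) / 2 * (norm z)\<^sup>2)"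
proof -
  have Y: "convex Y"
    using assms by (rule convex_on_imp_convex)
  have affine: "convex_on Y (\<lambda>z. a - b * (z \<bullet> c))" for a b :: real and c
    using Y by (intro convex_onI) (auto simp: inner_add_left algebra_simps)
  let ?l = "\<lambda>z. (1 / (2 * \<rho>)) * (norm (snd w))\<^sup>2 - (1 / \<rho>) * (z \<bullet> snd w)"
  have "convex_on Y ?l"
    by (rule affine)
  then have "convex_on Y (\<lambda>z. (g (fst w, z) + \<sigma> / 2 * (norm z)\<^sup>2) + ?l z)"
    by (rule convex_on_add[OF assms])
  also have "(\<lambda>z. (g (fst w, z) + \<sigma> / 2 * (norm z)\<^sup>2) + ?l z) =
      (\<lambda>z. moreau_objective g \<rho> w z - (1 / \<rho> - \<sigma>) / 2 * (norm z)\<^sup>2)"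
    by (rule ext) (simp add: moreau_objective_def power2_norm_eq_inner inner_diff_left
        inner_diff_right inner_commute algebra_simps diff_divide_distrib add_divide_distrib)
  finally show ?thesis .
qed

text \<open>With \<open>z\<close> frozen, \<open>g\<close> sees only the first component of
  \<open>v\<close>, so only \<open>fst D\<close> survives; the second component comes from the
  penalty alone.\<close>

lemma GDERIV_moreau_objective:
  fixes g :: "'a::real_inner \<times> 'b::real_inner \<Rightarrow> real"
  assumes "GDERIV g (fst v, z) :> D" and "\<rho> \<noteq> 0"
  shows "GDERIV (\<lambda>v. moreau_objective g \<rho> v z) v :> (fst D, (1 / \<rho>) *\<^sub>R (snd v - z))"
proof -
  have g: "((\<lambda>v. g (fst v, z)) has_derivative (\<lambda>h. (fst h, 0) \<bullet> D)) (at v)"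
    using assms(1) unfolding gderiv_def
    by (rule has_derivative_compose[rotated]) (auto intro!: derivative_eq_intros)
  have n: "((\<lambda>v. 1 / (2 * \<rho>) * (norm (z - snd v))\<^sup>2) has_derivative
      (\<lambda>h. 1 / \<rho> * (snd h \<bullet> (snd v - z)))) (at v)"
    unfolding power2_norm_eq_inner using \<open>\<rho> \<noteq> 0\<close>
    by (auto intro!: derivative_eq_intros simp: inner_diff_left inner_diff_right inner_commute
        algebra_simps diff_divide_distrib)
  show ?thesis
    unfolding gderiv_def moreau_objective_def
    by (rule has_derivative_eq_rhs[OF has_derivative_add[OF g n]])
      (auto simp: inner_prod_def)
qed

text \<open>The test point \<open>snd w\<close> carries zero penalty.\<close>

lemma moreau_env_le:
  fixes g :: "'a \<times> 'b::real_normed_vector \<Rightarrow> real"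
  assumes "compact Y" "continuous_on Y (moreau_objective g \<rho> w)" "snd w \<in> Y"
  shows "moreau_env g Y \<rho> w \<le> g w"
proof -
  have "bdd_below (moreau_objective g \<rho> w ` Y)"
    using assms by (intro bounded_imp_bdd_below compact_imp_bounded compact_continuous_image)
  then have "moreau_env g Y \<rho> w \<le> moreau_objective g \<rho> w (snd w)"
    unfolding moreau_env_def using assms(3) by (rule cINF_lower)
  then show ?thesis
    by (simp add: moreau_objective_def)
qed

text \<open>The first conjunct derives the gradient formula, so \<open>gradient\<close> of the gap
  in the constraint qualifications is a genuine derivative and not an unspecified \<open>THE\<close>
  value.\<close>

theorem proposition14:
  fixes X :: "(real ^ 'n) set" and Y :: "(real ^ 'm) set"
    and U :: "((real ^ 'n) \<times> (real ^ 'm)) set"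
    and g :: "(real ^ 'n) \<times> (real ^ 'm) \<Rightarrow> real"
    and \<sigma> \<rho> L :: real
  assumes X: "X \<noteq> {}" "compact X" "convex X"
    and Y: "Y \<noteq> {}" "compact Y" "convex Y"
    and U: "open U" "X \<times> Y \<subseteq> U"
    and g_diff: "\<And>w. w \<in> U \<Longrightarrow> g differentiable (at w)"
    and g_C1: "continuous_on U (gradient g)"
    and g_Lip: "L-lipschitz_on (X \<times> Y) (gradient g)"
    and sigma: "\<sigma> \<ge> 0"
    and weakly_convex: "\<And>x. x \<in> X \<Longrightarrow> convex_on Y (\<lambda>y. g (x, y) + \<sigma> / 2 * (norm y)\<^sup>2)"
    and rho: "\<rho> > 0" "\<rho> * \<sigma> < 1"
  shows "(\<forall>w \<in> X \<times> Y. GDERIV (moreau_gap g Y \<rho>) w :> moreau_gap_gradient g Y \<rho> w) \<and>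
    (\<forall>w \<in> X \<times> Y. moreau_gap g Y \<rho> w \<le> 0 \<longrightarrow>
      moreau_gap g Y \<rho> w = 0 \<and>
      0 \<in> (\<lambda>v. gradient (moreau_gap g Y \<rho>) w + v) ` normal_cone (X \<times> Y) w \<and>
      \<not> nnamcq (X \<times> Y) (moreau_gap g Y \<rho>) w \<and>
      \<not> mfcq (X \<times> Y) (moreau_gap g Y \<rho>) w) \<and>
    (\<forall>\<delta>>0. \<exists>w \<in> X \<times> Y. moreau_gap g Y \<rho> w < \<delta>)"
proof (intro conjI ballI impI allI)
  let ?H = "moreau_gap g Y \<rho>"
  let ?f = "\<lambda>p. moreau_objective g \<rho> (fst p) (snd p)"
  have g_grad: "GDERIV g w :> gradient g w" if "w \<in> U" for w
    using g_diff[OF that] by (rule GDERIV_gradient)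
  have g_cont: "isCont g w" if "w \<in> U" for w
    using g_diff[OF that] by (rule differentiable_imp_continuous_within)
  have in_U: "(fst w, z) \<in> U" if "w \<in> X \<times> Y" "z \<in> Y" for w z
    using U(2) that by auto
  have f_cont: "isCont ?f (w, z)" if "w \<in> X \<times> Y" "z \<in> Y" for w z
  proof -
    have "isCont (\<lambda>p. g (fst (fst p), snd p)) (w, z)"
      by (rule isCont_o2[where g = g])
        (auto intro!: continuous_intros g_cont in_U that)
    then show ?thesis
      unfolding moreau_objective_def by (intro continuous_intros)
  qed
  have obj_cont: "continuous_on Y (moreau_objective g \<rho> w)" if "w \<in> X \<times> Y" for w
  proof (intro continuous_at_imp_continuous_on ballI)
    fix z assume "z \<in> Y"
    have "isCont (\<lambda>z. (w, z)) z"
      by (intro continuous_intros)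
    from isCont_o2[OF this f_cont[OF that \<open>z \<in> Y\<close>]]
    show "isCont (moreau_objective g \<rho> w) z"
      by simp
  qed
  have argmin: "moreau_argmin g Y \<rho> w \<in> Y \<and> (\<forall>z\<in>Y. z \<noteq> moreau_argmin g Y \<rho> w \<longrightarrow>
      moreau_objective g \<rho> w (moreau_argmin g Y \<rho> w) < moreau_objective g \<rho> w z)"
    if w: "w \<in> X \<times> Y" for w
  proof -
    let ?h = "moreau_objective g \<rho> w"
    obtain u where u: "u \<in> Y" "\<And>z. z \<in> Y \<Longrightarrow> ?h u \<le> ?h z"
      using continuous_attains_inf[OF Y(2,1) obj_cont[OF w]] by blast
    have "convex_on Y (\<lambda>z. ?h z - (1 / \<rho> - \<sigma>) / 2 * (norm z)\<^sup>2)"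
      using w weakly_convex by (intro moreau_objective_minus_quadratic_convex) auto
    \<comment> \<open>This modulus of strong convexity is positive exactly because
      \<open>\<rho> * \<sigma> < 1\<close>.\<close>
    moreover have "0 < (1 / \<rho> - \<sigma>) / 2"
      using rho by (simp add: field_simps)
    ultimately have less: "?h u < ?h z" if "z \<in> Y" "z \<noteq> u" for z
      using strongly_convex_minimizer_unique Y(3) u that by blast
    have "moreau_argmin g Y \<rho> w = u"
      unfolding moreau_argmin_def is_arg_min_linorder
      by (rule the_equality) (use u less in \<open>auto simp: not_le[symmetric]\<close>)
    with u less show ?thesis
      by simp
  qed
  show grad: "GDERIV ?H w :> moreau_gap_gradient g Y \<rho> w" if w: "w \<in> X \<times> Y" for w
  proof -
    let ?z = "moreau_argmin g Y \<rho> w"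
    \<comment> \<open>The partial gradient in \<open>w\<close> of the Moreau objective, as a
      function of \<open>(w, z)\<close> jointly; \<open>?\<pi>\<close> maps
      \<open>((x, y), z)\<close> to the point \<open>(x, z)\<close> at which \<open>g\<close> is
      evaluated.\<close>
    let ?G = "\<lambda>p. (fst (gradient g (fst (fst p), snd p)), (1 / \<rho>) *\<^sub>R (snd (fst p) - snd p))"
    let ?\<pi> = "\<lambda>p :: ((real ^ 'n) \<times> (real ^ 'm)) \<times> (real ^ 'm). (fst (fst p), snd p)"
    have z: "?z \<in> Y"
      using argmin[OF w] by blast
    have \<pi>: "isCont ?\<pi> (w, ?z)"
      by (intro continuous_intros)
    have "isCont (gradient g) (?\<pi> (w, ?z))"
      using g_C1 U(1) in_U[OF w z] by (simp add: continuous_on_eq_continuous_at)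
    from isCont_o2[OF \<pi> this] have G_cont: "isCont ?G (w, ?z)"
      by (intro continuous_intros)
    \<comment> \<open>Nearby points may leave \<open>X \<times> Y\<close>; openness of
      \<open>U\<close> keeps \<open>g\<close> differentiable there, also when \<open>w\<close> or
      \<open>?z\<close> is a boundary point.\<close>
    have "\<forall>\<^sub>F p in nhds (w, ?z). ?\<pi> p \<in> U"
    proof -
      have "(?\<pi> \<longlongrightarrow> ?\<pi> (w, ?z)) (nhds (w, ?z))"
        by (intro tendsto_intros filterlim_ident)
      moreover have "?\<pi> (w, ?z) \<in> U"
        using in_U[OF w z] by simp
      ultimately show ?thesis
        using U(1) by (intro topological_tendstoD)
    qed
    then have der: "\<forall>\<^sub>F p in nhds (w, ?z). GDERIV (\<lambda>v. ?f (v, snd p)) (fst p) :> ?G p"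
    proof eventually_elim
      case (elim p)
      then show ?case
        using GDERIV_moreau_objective[OF g_grad, of "fst p" "snd p" \<rho>] rho(1) by simp
    qed
    have "GDERIV (\<lambda>v. INF z\<in>Y. ?f (v, z)) w :> ?G (w, ?z)"
      by (rule GDERIV_INF_unique_minimizer[OF Y(2) z _ f_cont[OF w] der G_cont])
        (use argmin[OF w] in auto)
    then have "GDERIV (moreau_env g Y \<rho>) w :> ?G (w, ?z)"
      unfolding moreau_env_def by simp
    with g_grad[of w] w U(2) have "GDERIV ?H w :> gradient g w - ?G (w, ?z)"
      unfolding moreau_gap_def by (intro GDERIV_diff) auto
    then show ?thesis
      by (simp add: moreau_gap_gradient_def Let_def minus_prod_def)
  qed
  have nonneg: "0 \<le> ?H w" if "w \<in> X \<times> Y" for w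
    using moreau_env_le[OF Y(2) obj_cont[OF that]] that by (auto simp: moreau_gap_def)
  fix w assume w: "w \<in> X \<times> Y" and feasible: "?H w \<le> 0"
  show zero: "?H w = 0"
    using nonneg[OF w] feasible by simp
  have cone: "- gradient ?H w \<in> normal_cone (X \<times> Y) w"
    unfolding gradient_eq[OF grad[OF w]]
    by (rule neg_GDERIV_in_normal_cone[OF grad[OF w]])
      (use w zero nonneg X(3) Y(3) in \<open>auto intro: convex_Times\<close>)
  from neg_normal_cone_imp_not_nnamcq[where R = ?H, OF zero cone]
  show "0 \<in> (\<lambda>v. gradient ?H w + v) ` normal_cone (X \<times> Y) w" "\<not> nnamcq (X \<times> Y) ?H w" .
  show "\<not> mfcq (X \<times> Y) ?H w"
    using neg_normal_cone_imp_not_mfcq[where R = ?H, OF zero cone] .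
next
  fix \<delta> :: real assume "\<delta> > 0"
  obtain x where x: "x \<in> X"
    using X(1) by blast
  have "continuous_on U g"
    using g_diff
    by (intro continuous_at_imp_continuous_on ballI differentiable_imp_continuous_within)
  then have "continuous_on Y (\<lambda>y. g (x, y))"
    by (rule continuous_on_compose2) (use x U(2) in \<open>auto intro!: continuous_intros\<close>)
  then obtain y where y: "y \<in> Y" "\<And>z. z \<in> Y \<Longrightarrow> g (x, y) \<le> g (x, z)"
    using continuous_attains_inf[OF Y(2,1)] by blast
  \<comment> \<open>For every \<open>z\<close> in \<open>Y\<close> the penalty is nonnegative and
    \<open>g (x, z)\<close> is at least \<open>g (x, y)\<close>. Hence the gap at this point is at
    most 0, and the same point serves every \<open>\<delta>\<close>.\<close>
  have "g (x, y) \<le> moreau_env g Y \<rho> (x, y)"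
    unfolding moreau_env_def moreau_objective_def
    using Y(1) y(2) rho(1) by (intro cINF_greatest) (auto intro!: add_increasing2)
  with \<open>\<delta> > 0\<close> have "moreau_gap g Y \<rho> (x, y) < \<delta>"
    by (simp add: moreau_gap_def)
  with x y(1) show "\<exists>w \<in> X \<times> Y. moreau_gap g Y \<rho> w < \<delta>"
    by blast
qed

end
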